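(* Let $k>1$ be an integer. The largest even positive integer $n$ with $\lambda(n)=k$ is $2^{k+1}$, and every odd positive integer $n$ with $\lambda(n)=k$ satisfies $n<2^k$.
   Context: Let $\overline{\psi}$ be the multiplicative arithmetic function with $\overline{\psi}(p^{\alpha})=p^{\alpha-1}(p+1)$ for odd primes $p$ and $\overline{\psi}(2^{\alpha})=2^{\alpha-1}$, for all positive integers $\alpha$ (so $\overline{\psi}(1)=1$). For $n>1$, $\lambda(n)$ is the unique nonnegative integer with $\overline{\psi}^{\lambda(n)}(n)=2$ (where $\overline{\psi}^k$ is the $k$-th iterate, $\overline{\psi}^0(n)=n$), and $\lambda(1)=0$. *)

theory Defs
  imports "HOL-Computational_Algebra.Primes"
begin

text \<open>The value at 0 is irrelevant: arithmetic functions are considered on positive integers only.\<close>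

definition psibar :: "nat \<Rightarrow> nat" where
  "psibar n = (\<Prod>p\<in>prime_factors n.
     if p = 2 then 2 ^ (multiplicity p n - 1)
     else p ^ (multiplicity p n - 1) * (p + 1))"

text \<open>The following three facts are the defining properties of the function.\<close>

lemma psibar_1 [simp]: "psibar 1 = 1"
  by (simp add: psibar_def)

lemma psibar_prime_power:
  assumes "prime p" and "a > 0"
  shows "psibar (p ^ a) = (if p = 2 then 2 ^ (a - 1) else p ^ (a - 1) * (p + 1))"
proof -
  have "prime_factors (p ^ a) = {p}"
    using assms by (auto simp: in_prime_factors_iff prime_gt_0_nat
        intro: primes_dvd_imp_eq prime_dvd_power)
  moreover have "multiplicity p (p ^ a) = a"
    using assms by (simp add: multiplicity_same_power prime_gt_0_nat not_prime_unit)
  ultimately show ?thesis unfolding psibar_def by (simp only: prod.insert finite.emptyI empty_iff prod.empty) simp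
qed

lemma psibar_mult_coprime:
  assumes "m > 0" and "n > 0" and "coprime m n"
  shows "psibar (m * n) = psibar m * psibar n"
proof -
  define g where "g p e = (if p = 2 then 2 ^ (e - 1) else p ^ (e - 1) * (p + 1))"
    for p e :: nat
  have disj: "prime_factors m \<inter> prime_factors n = {}"
    using assms(3) by (auto simp: in_prime_factors_iff dest: coprime_common_divisor_nat)
  have mult: "multiplicity p (m * n) = multiplicity p m + multiplicity p n" if "prime p" for p
    using that assms by (simp add: prime_elem_multiplicity_mult_distrib)
  have zn: "multiplicity p n = 0" if "p \<in> prime_factors m" for p
    using that disj assms by (intro not_dvd_imp_multiplicity_0) (auto simp: in_prime_factors_iff)
  have zm: "multiplicity p m = 0" if "p \<in> prime_factors n" for p
    using that disj assms by (intro not_dvd_imp_multiplicity_0) (auto simp: in_prime_factors_iff)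
  have "psibar (m * n) = (\<Prod>p\<in>prime_factors m \<union> prime_factors n. g p (multiplicity p (m * n)))"
    using assms by (simp add: psibar_def g_def prime_factors_product)
  also have "\<dots> = (\<Prod>p\<in>prime_factors m. g p (multiplicity p (m * n))) *
                    (\<Prod>p\<in>prime_factors n. g p (multiplicity p (m * n)))"
    using disj by (intro prod.union_disjoint) auto
  also have "(\<Prod>p\<in>prime_factors m. g p (multiplicity p (m * n))) = psibar m"
    unfolding psibar_def
    by (intro prod.cong refl) (simp add: g_def mult zn in_prime_factors_imp_prime)
  also have "(\<Prod>p\<in>prime_factors n. g p (multiplicity p (m * n))) = psibar n"
    unfolding psibar_def
    by (intro prod.cong refl) (simp add: g_def mult zm in_prime_factors_imp_prime)
  finally show ?thesis .
qed

text \<open>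
  At most one exponent can qualify, since 2 is mapped to 1 and 1 to itself. The value at 0 is
  unspecified, so statements about this function must restrict to positive arguments.
\<close>

definition lambda :: "nat \<Rightarrow> nat" where
  "lambda n = (if n = 1 then 0 else (THE k. (psibar ^^ k) n = 2))"

end

theory Submission imports Defs begin

text \<open>
  Applying \<open>psibar\<close> at most halves an even number and strictly increases an odd number above 1;
  moreover \<open>psibar n\<close> is even for \<open>n > 2\<close>. Induction on \<open>lambda n\<close> then gives
  \<open>n \<le> 2 ^ (lambda n + 1)\<close> for even \<open>n\<close>, and one more step gives the odd case.
  That the iteration reaches 2 at all is not a matter of size, since \<open>psibar\<close> can increase even
  numbers. Instead one uses the completely additive weight with value 1 at 2 and value
  \<open>1 + weight (p + 1)\<close> at an odd prime \<open>p\<close>: each step lowers it by the number of distinct prime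
  factors.
\<close>

section \<open>A weight that drops at every step\<close>

lemma prime_dvd_Suc_odd_less:
  fixes p q :: nat
  assumes "odd p" "p > 1" "prime q" "q dvd Suc p"
  shows "q < p"
proof -
  obtain m where m: "Suc p = 2 * m"
    using assms(1) by (metis dvd_def even_Suc)
  have "q dvd 2 \<or> q dvd m"
    using assms m by (metis prime_dvd_mult_nat)
  then have "q \<le> 2 \<or> q \<le> m"
    using m by (auto dest!: dvd_imp_le)
  moreover have "p \<ge> 3"
    using assms(1,2) by presburger
  ultimately show ?thesis
    using m by linarith
qed

text \<open>The guard asks for just what makes every prime factor of \<open>Suc p\<close> smaller
  than \<open>p\<close>, so that the recursion terminates; \<open>weight\<close> evaluates it at
  primes only.\<close>

function prime_weight :: "nat \<Rightarrow> nat" where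
  "prime_weight p = (if odd p \<and> p > 1
     then Suc (\<Sum>q\<in>#prime_factorization (Suc p). prime_weight q) else 1)"
  by auto
termination
  by (relation "measure id")
     (auto simp: in_prime_factors_iff intro: prime_dvd_Suc_odd_less)

declare prime_weight.simps [simp del]

definition weight :: "nat \<Rightarrow> nat" where
  "weight n = (\<Sum>q\<in>#prime_factorization n. prime_weight q)"

lemma weight_1 [simp]: "weight (Suc 0) = 0"
  by (simp add: weight_def)

lemma weight_mult: "m > 0 \<Longrightarrow> n > 0 \<Longrightarrow> weight (m * n) = weight m + weight n"
  by (simp add: weight_def prime_factorization_mult)

lemma weight_power: "n > 0 \<Longrightarrow> weight (n ^ e) = e * weight n"
  by (induction e) (simp_all add: weight_mult)

lemma weight_2: "weight 2 = 1"
  by (simp add: weight_def prime_factorization_prime prime_weight.simps)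

lemma weight_odd_prime:
  assumes "prime p" "p \<noteq> 2"
  shows "weight p = Suc (weight (Suc p))"
proof -
  have "odd p" "p > 1"
    using assms primes_dvd_imp_eq two_is_prime_nat prime_gt_1_nat by blast+
  then show ?thesis
    using assms by (simp add: weight_def prime_factorization_prime prime_weight.simps[of p])
qed

lemma weight_prod:
  "finite A \<Longrightarrow> (\<And>x. x \<in> A \<Longrightarrow> f x > 0) \<Longrightarrow> weight (prod f A) = (\<Sum>x\<in>A. weight (f x))"
  by (induction A rule: finite_induct) (simp_all add: weight_mult prod_pos)

text \<open>Compared one prime at a time: an odd \<open>p\<close> trades one factor \<open>p\<close>
  for \<open>p + 1\<close>, which weighs one less by \<open>weight_odd_prime\<close>, and 2 loses
  one factor of weight 1.\<close>

lemma weight_psibar_less: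
  assumes "n > 1"
  shows "weight (psibar n) < weight n"
proof -
  let ?f = "\<lambda>p. if p = 2 then 2 ^ (multiplicity p n - 1)
     else p ^ (multiplicity p n - 1) * (p + 1)"
  have less: "weight (?f p) < weight (p ^ multiplicity p n)" if "p \<in> prime_factors n" for p
  proof -
    have p: "prime p" "p > 0"
      using that by (auto intro: prime_gt_0_nat)
    have "multiplicity p n > 0"
      using that by (simp add: prime_factors_multiplicity)
    then obtain e where e: "multiplicity p n = Suc e"
      using gr0_implies_Suc by blast
    show ?thesis
      using p e weight_odd_prime[of p]
      by (auto simp: weight_mult weight_power weight_2 simp del: mult_Suc_right)
  qed
  have pos: "p > 0" if "p \<in> prime_factors n" for p
    using that by (auto intro: prime_gt_0_nat)
  have "weight (psibar n) = (\<Sum>p\<in>prime_factors n. weight (?f p))"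
    unfolding psibar_def using pos by (intro weight_prod) auto
  also have "\<dots> < (\<Sum>p\<in>prime_factors n. weight (p ^ multiplicity p n))"
    using assms less by (intro sum_strict_mono) (auto simp: prime_factorization_empty_iff)
  also have "\<dots> = weight (\<Prod>p\<in>prime_factors n. p ^ multiplicity p n)"
    using pos by (intro weight_prod[symmetric]) auto
  also have "\<dots> = weight n"
    using assms prime_factorization_nat[of n] by simp
  finally show ?thesis .
qed

section \<open>Growth and parity of \<open>psibar\<close>\<close>

lemma psibar_odd_gt:
  assumes "odd n" "n > 1"
  shows "n < psibar n"
proof -
  have less: "p ^ multiplicity p n < p ^ (multiplicity p n - 1) * (p + 1)"
    if "p \<in> prime_factors n" for p
  proof -
    have "multiplicity p n > 0"
      using that by (simp add: prime_factors_multiplicity)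
    then obtain e where "multiplicity p n = Suc e"
      using gr0_implies_Suc by blast
    then show ?thesis
      using that by (auto intro: prime_gt_0_nat)
  qed
  have not2: "p \<noteq> 2" if "p \<in> prime_factors n" for p
    using that assms by auto
  obtain q where q: "q \<in> prime_factors n"
    using assms prime_factor_nat[of n] by (auto simp: in_prime_factors_iff)
  have "n = (\<Prod>p\<in>prime_factors n. p ^ multiplicity p n)"
    using assms prime_factorization_nat[of n] by simp
  also have "\<dots> < (\<Prod>p\<in>prime_factors n. p ^ (multiplicity p n - 1) * (p + 1))"
    using q less by (intro prod_mono_strict[of q]) (auto intro: less_imp_le prime_gt_0_nat
      simp del: mult_Suc_right)
  also have "\<dots> = psibar n"
    unfolding psibar_def using not2 by (intro prod.cong) auto
  finally show ?thesis .
qed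

text \<open>Any prime factor \<open>p\<close> is odd and contributes the even factor
  \<open>p + 1\<close>.\<close>

lemma even_psibar_odd:
  assumes "odd n" "n > 1"
  shows "even (psibar n)"
proof -
  obtain p where "prime p" "p dvd n"
    using assms prime_factor_nat[of n] by auto
  then have p: "p \<in> prime_factors n"
    using assms by (auto simp: in_prime_factors_iff)
  then have "odd p"
    using assms by (auto simp: in_prime_factors_iff)
  then have "even (if p = 2 then 2 ^ (multiplicity p n - 1)
     else p ^ (multiplicity p n - 1) * (p + 1))"
    by auto
  then show ?thesis
    unfolding psibar_def using p by (meson dvd_prodI dvd_trans finite_set_mset)
qed

lemma psibar_even_decomp:
  assumes "even n" "n > 0"
  obtains a m where "n = 2 ^ Suc a * m" "odd m" "psibar n = 2 ^ a * psibar m"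
proof -
  obtain a m where m: "n = 2 ^ a * m" "odd m"
    using assms multiplicity_decompose'[of n 2] by (metis bot_nat_0.not_eq_extremum odd_one)
  obtain b where b: "a = Suc b"
    using m assms by (cases a) auto
  have "psibar n = psibar (2 ^ Suc b) * psibar m"
    unfolding m b using m by (intro psibar_mult_coprime) (auto intro: odd_pos)
  also have "psibar (2 ^ Suc b) = 2 ^ b"
    using psibar_prime_power[of 2 "Suc b"] by simp
  finally show ?thesis
    using that m b by blast
qed

lemma psibar_even_ge:
  assumes "even n" "n > 0"
  shows "n \<le> 2 * psibar n"
proof -
  obtain a m where m: "n = 2 ^ Suc a * m" "odd m" "psibar n = 2 ^ a * psibar m"
    using psibar_even_decomp[OF assms] .
  \<comment> \<open>Only weak here: the growth of odd numbers is strict above 1, while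
    \<open>m = 1\<close>, the case of a power of 2, is fixed.\<close>
  have "m \<le> psibar m"
    using psibar_odd_gt[of m] m(2) odd_pos[OF m(2)] by (cases "m = 1") (auto simp flip: One_nat_def)
  then show ?thesis
    using m by simp
qed

lemma even_psibar:
  assumes "n > 2"
  shows "even (psibar n)"
proof (cases "even n")
  case True
  with assms obtain a m where m: "n = 2 ^ Suc a * m" "odd m" "psibar n = 2 ^ a * psibar m"
    using psibar_even_decomp[of n] by auto
  show ?thesis
  proof (cases "m = 1")
    case True
    \<comment> \<open>For a pure power of 2, \<open>n > 2\<close> leaves a factor 2 after the
      halving.\<close>
    then have "a > 0"
      using m assms by (cases a) auto
    then show ?thesis
      using m by simp
  next
    case False
    then show ?thesis
      using even_psibar_odd[of m] m odd_pos[OF m(2)] by auto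
  qed
next
  case False
  then show ?thesis
    using assms by (intro even_psibar_odd) auto
qed

lemma psibar_gt_1:
  assumes "n > 2"
  shows "psibar n > 1"
  using assms psibar_even_ge[of n] psibar_odd_gt[of n] by (cases "even n") auto

section \<open>Reaching 2 and the recursion for \<open>lambda\<close>\<close>

lemma psibar_2: "psibar 2 = 1"
  using psibar_prime_power[of 2 1] by simp

lemma psibar_reaches_2: "n > 1 \<Longrightarrow> \<exists>k. (psibar ^^ k) n = 2"
proof (induction "weight n" arbitrary: n rule: less_induct)
  case less
  show ?case
  proof (cases "n = 2")
    case True
    then have "(psibar ^^ 0) n = 2"
      by simp
    then show ?thesis ..
  next
    case False
    then obtain k where "(psibar ^^ k) (psibar n) = 2"
      using less.hyps[OF weight_psibar_less] less.prems psibar_gt_1[of n] by auto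
    then have "(psibar ^^ Suc k) n = 2"
      by (simp add: funpow_swap1)
    then show ?thesis ..
  qed
qed

text \<open>After 2 the orbit stays at 1 and never returns to 2. This makes the description in
  \<open>lambda\<close> well defined.\<close>

lemma psibar_funpow_eq_2_unique:
  assumes "(psibar ^^ j) n = 2" "(psibar ^^ k) n = 2"
  shows "j = k"
proof -
  have one: "(psibar ^^ d) 1 = 1" for d
    by (induction d) (simp_all del: One_nat_def)
  have "\<not> i < l" if "(psibar ^^ i) n = 2" "(psibar ^^ l) n = 2" for i l
  proof
    assume "i < l"
    then obtain d where "l = d + Suc i"
      using less_imp_Suc_add[of i l] by (auto simp: add.commute)
    then have "(psibar ^^ l) n = (psibar ^^ d) (psibar ((psibar ^^ i) n))"
      by (simp add: funpow_add del: add_Suc_right)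
    then have "(psibar ^^ l) n = 1"
      by (simp only: that psibar_2 one)
    with that show False
      by simp
  qed
  from this[OF assms] this[OF assms(2,1)] show ?thesis
    by simp
qed

lemma lambda_eq:
  assumes "(psibar ^^ k) n = 2" "n \<noteq> 1"
  shows "lambda n = k"
  using assms psibar_funpow_eq_2_unique by (auto simp: lambda_def intro!: the_equality)

lemma lambda_2: "lambda 2 = 0"
  by (rule lambda_eq) simp_all

text \<open>The recursion starts above 2, because \<open>lambda 2\<close> and the conventional
  \<open>lambda 1\<close> are both 0.\<close>

lemma lambda_psibar:
  assumes "n > 2"
  shows "lambda n = Suc (lambda (psibar n))"
proof -
  obtain k where k: "(psibar ^^ k) (psibar n) = 2"
    using psibar_reaches_2 psibar_gt_1 assms by blast
  then have "lambda (psibar n) = k"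
    using psibar_gt_1[OF assms] by (intro lambda_eq) auto
  moreover have "lambda n = Suc k"
    using k assms by (intro lambda_eq) (auto simp: funpow_swap1)
  ultimately show ?thesis
    by simp
qed

section \<open>Extremal values\<close>

lemma lambda_power_2: "lambda (2 ^ Suc k) = k"
proof (induction k)
  case 0
  show ?case
    by (simp add: lambda_2)
next
  case (Suc k)
  have "(2 :: nat) ^ Suc (Suc k) > 2"
    using power_strict_increasing[of 1 "Suc (Suc k)" "2 :: nat"] by simp
  then have "lambda (2 ^ Suc (Suc k)) = Suc (lambda (psibar (2 ^ Suc (Suc k))))"
    by (rule lambda_psibar)
  also have "psibar (2 ^ Suc (Suc k)) = 2 ^ Suc k"
    using psibar_prime_power[of 2 "Suc (Suc k)"] by simp
  finally show ?case
    using Suc.IH by simp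
qed

lemma even_le_power_lambda:
  "even n \<Longrightarrow> n > 0 \<Longrightarrow> n \<le> 2 ^ Suc (lambda n)"
proof (induction "lambda n" arbitrary: n rule: less_induct)
  case less
  show ?case
  proof (cases "n > 2")
    case True
    note rec = lambda_psibar[OF True]
    \<comment> \<open>The induction hypothesis applies because \<open>psibar n\<close> is again even
      and positive; the halving bound then costs one factor 2, matched by the increase of
      \<open>lambda\<close> by one.\<close>
    have "psibar n \<le> 2 ^ Suc (lambda (psibar n))"
      using less.hyps[of "psibar n"] rec even_psibar[OF True] psibar_gt_1[OF True] by simp
    then show ?thesis
      using psibar_even_ge[OF less.prems] rec by simp
  next
    case False
    then have "n = 2"
      using less.prems by presburger
    then show ?thesis
      by (simp add: lambda_2)
  qed
qed

text \<open>The first step goes up to an even number whose \<open>lambda\<close> is one smaller,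
  which saves a factor 2 against the even bound.\<close>

lemma odd_less_power_lambda:
  assumes "odd n" "n > 1"
  shows "n < 2 ^ lambda n"
proof -
  have "n > 2"
    using assms by presburger
  have "n < psibar n"
    by (rule psibar_odd_gt) fact+
  also have "\<dots> \<le> 2 ^ Suc (lambda (psibar n))"
    using \<open>n > 2\<close> even_psibar psibar_gt_1[of n] by (intro even_le_power_lambda) auto
  also have "Suc (lambda (psibar n)) = lambda n"
    using lambda_psibar[OF \<open>n > 2\<close>] by simp
  finally show ?thesis .
qed

theorem theorem2p3:
  fixes k :: nat
  assumes "k > 1"
  shows "(2 ^ (k + 1) \<in> {n :: nat. n > 0 \<and> even n \<and> lambda n = k} \<and>
          (\<forall>n \<in> {n :: nat. n > 0 \<and> even n \<and> lambda n = k}. n \<le> 2 ^ (k + 1))) \<and>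
         (\<forall>n :: nat. n > 0 \<and> odd n \<and> lambda n = k \<longrightarrow> n < 2 ^ k)"
proof (intro conjI ballI allI impI)
  show "2 ^ (k + 1) \<in> {n :: nat. n > 0 \<and> even n \<and> lambda n = k}"
    using lambda_power_2[of k] by simp
next
  fix n :: nat
  assume "n \<in> {n. n > 0 \<and> even n \<and> lambda n = k}"
  then show "n \<le> 2 ^ (k + 1)"
    using even_le_power_lambda[of n] by auto
next
  fix n :: nat
  assume n: "n > 0 \<and> odd n \<and> lambda n = k"
  \<comment> \<open>At 1 the convention gives \<open>lambda\<close> the value 0, whereas
    \<open>k > 1\<close>.\<close>
  then have "n \<noteq> 1"
    using assms by (auto simp: lambda_def)
  then show "n < 2 ^ k"
    using n odd_less_power_lambda[of n] by auto
qed

end
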